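(* Let $G$ be a connected graph of order $n$ with girth $g(G)\geq 7$, and let $n_L$ be the number of end-vertices of $G$. Then (1) $\gamma_{\rm wcon}(G)=n-n_L$; (2) $\gamma_{\rm wcon}(G)=\gamma_c(G)$ if and only if every vertex of $G$ is either an end-vertex or a cut-vertex.
   Context: Graphs are finite, simple, undirected, connected. $g(G)$ is the length of a shortest cycle (infinite for acyclic graphs). An end-vertex is a vertex of degree 1; a cut-vertex is a vertex whose removal increases the number of components. A set $D$ is dominating if every vertex outside $D$ has a neighbour in $D$; connected dominating if also $G[D]$ is connected; weakly convex if for any $a,b\in D$ some shortest $(a-b)$-path in $G$ lies in $D$. $\gamma_c(G)$, $\gamma_{\rm wcon}(G)$ denote the minimum sizes of a connected dominating set and a weakly convex dominating set.
   Formalization: Part (1) is stated for n ≠ 2, since for K_2 one has n − n_L = 0 but γ_wcon = 1; part (2) is stated for n ≠ 1, since for K_1 γ_wcon = γ_c = 1 but its vertex is neither an end-vertex nor a cut-vertex. *)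

theory Defs
  imports "Graph_Theory.Graph_Theory"
begin

text \<open>
  Finite simple graphs are modelled by the locale predicate \<^const>\<open>graph\<close>: finite, loop-free
  symmetric digraphs without parallel arcs, an edge \<open>uv\<close> being the pair of arcs \<open>u \<rightarrow> v\<close>, \<open>v \<rightarrow> u\<close>.
\<close>

text \<open>
  In a symmetric digraph the library notion of cycle also covers the closed walk \<open>u, v, u\<close>. In a
  simple graph, the cycles of length at least 3 are exactly the undirected cycles. The infimum
  over the empty set is \<open>\<infinity>\<close>, so acyclic graphs have infinite girth.
\<close>

definition girth :: "('a, 'b) pre_digraph \<Rightarrow> enat" where
  "girth G = (INF p \<in> {p. pre_digraph.cycle G p \<and> 3 \<le> length p}. enat (length p))"

text \<open>
  Every edge at \<open>v\<close> contributes exactly one outgoing arc, so the out-degree is the undirected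
  degree.
\<close>

definition end_vertex :: "('a, 'b) pre_digraph \<Rightarrow> 'a \<Rightarrow> bool" where
  "end_vertex G v \<longleftrightarrow> v \<in> verts G \<and> out_degree G v = 1"

text \<open>
  For symmetric digraphs the strongly connected components are the connected components of the
  undirected graph.
\<close>

definition cut_vertex :: "('a, 'b) pre_digraph \<Rightarrow> 'a \<Rightarrow> bool" where
  "cut_vertex G v \<longleftrightarrow> v \<in> verts G \<and>
     card (pre_digraph.sccs_verts (pre_digraph.del_vert G v)) > card (pre_digraph.sccs_verts G)"

definition shortest_path ::
    "('a, 'b) pre_digraph \<Rightarrow> 'a \<Rightarrow> 'b awalk \<Rightarrow> 'a \<Rightarrow> bool" where
  "shortest_path G a p b \<longleftrightarrow> pre_digraph.apath G a p b \<and>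
     (\<forall>q. pre_digraph.apath G a q b \<longrightarrow> length p \<le> length q)"

definition dominating_set :: "('a, 'b) pre_digraph \<Rightarrow> 'a set \<Rightarrow> bool" where
  "dominating_set G D \<longleftrightarrow> D \<subseteq> verts G \<and> (\<forall>v \<in> verts G - D. \<exists>u \<in> D. v \<rightarrow>\<^bsub>G\<^esub> u)"

definition connected_dominating_set :: "('a, 'b) pre_digraph \<Rightarrow> 'a set \<Rightarrow> bool" where
  "connected_dominating_set G D \<longleftrightarrow> dominating_set G D \<and> Digraph_Component.connected (G \<restriction> D)"

definition weakly_convex :: "('a, 'b) pre_digraph \<Rightarrow> 'a set \<Rightarrow> bool" where
  "weakly_convex G D \<longleftrightarrow> D \<subseteq> verts G \<and>
     (\<forall>a \<in> D. \<forall>b \<in> D. \<exists>p. shortest_path G a p b \<and> set (pre_digraph.awalk_verts G a p) \<subseteq> D)"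

text \<open>
  In a finite connected graph the sets below are finite and nonempty, since the whole vertex set
  qualifies.
\<close>

definition gamma_c :: "('a, 'b) pre_digraph \<Rightarrow> nat" where
  "gamma_c G = Min (card ` {D. connected_dominating_set G D})"

definition gamma_wcon :: "('a, 'b) pre_digraph \<Rightarrow> nat" where
  "gamma_wcon G = Min (card ` {D. dominating_set G D \<and> weakly_convex G D})"

end

theory Submission
  imports Defs
begin

text \<open>
  Let \<open>D\<close> be a weakly convex dominating set missing a vertex \<open>v\<close> of degree at least two, and let
  \<open>u\<close>, \<open>w\<close> be neighbours of \<open>v\<close> with \<open>u \<in> D\<close>. Either \<open>w\<close> or a neighbour of \<open>w\<close> lies in \<open>D\<close>,
  which gives a path of length 2 or 3 joining two vertices of \<open>D\<close> with its interior outside \<open>D\<close>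
  (or a triangle). Closing it with a shortest path inside \<open>D\<close> produces a cycle of length at most 6.
  So \<open>D\<close> contains the set \<open>N\<close> of all vertices that are not end-vertices, and \<open>N\<close> itself is weakly
  convex because a path has no end-vertex in its interior.

  A connected dominating set contains all cut-vertices, so \<open>N\<close> is minimum among the connected
  dominating sets as soon as it consists of cut-vertices. Conversely, a vertex of \<open>N\<close> that is not a
  cut-vertex has no end-vertex as a neighbour and can be removed from \<open>N\<close>.
\<close>

section \<open>Connectivity, degrees and paths in simple graphs\<close>

text \<open>Serves to evaluate the component counts in \<open>cut_vertex\<close>: any two vertices
  reach each other, so the whole vertex set is the only component.\<close>

lemma strongly_connected_card_sccs_verts:
  assumes "strongly_connected H"
  shows "card (pre_digraph.sccs_verts H) = 1"
proof -
  have reach: "u \<rightarrow>\<^sup>*\<^bsub>H\<^esub> v \<longleftrightarrow> u \<in> verts H \<and> v \<in> verts H" for u v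
    using assms by (auto simp: strongly_connected_def dest: reachable_in_vertsE elim: reachable_in_vertsE)
  have "pre_digraph.sccs_verts H = {verts H}"
    using assms unfolding pre_digraph.sccs_verts_def reach strongly_connected_def by blast
  then show ?thesis by simp
qed

context graph
begin

text \<open>Without parallel arcs, \<open>head G\<close> is injective on the arcs leaving
  \<open>v\<close>, so the out-degree counts neighbours.\<close>

lemma end_vertex_iff: "end_vertex G v \<longleftrightarrow> (\<exists>!w. v \<rightarrow>\<^bsub>G\<^esub> w)"
proof -
  have inj: "inj_on (head G) (out_arcs G v)"
    by (rule inj_onI) (auto intro: no_multi_arcs simp: arc_to_ends_def)
  have img: "head G ` out_arcs G v = {w. v \<rightarrow>\<^bsub>G\<^esub> w}"
    by (auto simp: arcs_ends_conv)
  have "out_degree G v = card {w. v \<rightarrow>\<^bsub>G\<^esub> w}"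
    using card_image[OF inj] unfolding img out_degree_def by simp
  then have "out_degree G v = 1 \<longleftrightarrow> (\<exists>w. {w. v \<rightarrow>\<^bsub>G\<^esub> w} = {w})"
    by (simp add: card_1_singleton_iff)
  also have "\<dots> \<longleftrightarrow> (\<exists>!w. v \<rightarrow>\<^bsub>G\<^esub> w)"
    by (auto simp: set_eq_iff)
  finally have "out_degree G v = 1 \<longleftrightarrow> (\<exists>!w. v \<rightarrow>\<^bsub>G\<^esub> w)" .
  then show ?thesis
    unfolding end_vertex_def using adj_in_verts by blast
qed

lemma strongly_connected_if_connected:
  assumes "connected G"
  shows "strongly_connected G"
  using assms sym_arcs
  by (auto simp: connected_def strongly_connected_def reachable_mk_symmetric_eq)

lemma ex_neighbour:
  assumes "strongly_connected G" "card (verts G) \<noteq> 1" "v \<in> verts G"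
  obtains w where "v \<rightarrow>\<^bsub>G\<^esub> w"
proof -
  have "verts G \<noteq> {v}" using assms(2) by auto
  then obtain x where x: "x \<in> verts G" "x \<noteq> v" using assms(3) by blast
  then have "v \<rightarrow>\<^sup>* x" using assms(1,3) by (auto simp: strongly_connected_def)
  then show ?thesis using x that by (cases rule: converse_reachable_cases) auto
qed

lemma ex_shortest_path:
  assumes "strongly_connected G" "a \<in> verts G" "b \<in> verts G"
  obtains p where "shortest_path G a p b"
proof -
  have "\<exists>p. apath a p b"
    using assms reachable_apath by (auto simp: strongly_connected_def)
  then obtain p where "apath a p b" "\<forall>q. apath a q b \<longrightarrow> length p \<le> length q"
    using ex_has_least_nat[of "\<lambda>p. apath a p b" _ length] by blast
  then show ?thesis using that by (auto simp: shortest_path_def)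
qed

text \<open>An interior visit to \<open>z\<close> enters from one neighbour and leaves to another; a
  single neighbour would have to occur twice on the path.\<close>

lemma end_vertex_on_apath:
  assumes p: "apath a p b" and z: "z \<in> set (awalk_verts a p)" and "end_vertex G z"
  shows "z = a \<or> z = b"
proof (rule ccontr)
  assume contr: "\<not> (z = a \<or> z = b)"
  from p have walk: "awalk a p b" by (rule awalkI_apath)
  from awalk_decomp[OF walk z] obtain q r
    where qr: "p = q @ r" "awalk a q z" "awalk z r b" by blast
  have "q \<noteq> []" "r \<noteq> []" using qr contr by (auto simp: awalk_Nil_iff)
  then obtain q' e f r' where q: "q = q' @ [e]" and r: "r = f # r'"
    by (metis list.exhaust rev_exhaust)
  have e: "e \<in> arcs G" "head G e = z" and f: "f \<in> arcs G" "tail G f = z"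
    using qr q r by (auto simp: awalk_simps)
  have "z \<rightarrow>\<^bsub>G\<^esub> tail G e" "z \<rightarrow>\<^bsub>G\<^esub> head G f"
    using e f in_arcs_imp_in_arcs_ends[of e] in_arcs_imp_in_arcs_ends[of f]
    by (auto intro: graph_symmetric)
  then have eq: "tail G e = head G f"
    using assms(3) end_vertex_iff by blast
  have "tail G e \<in> set (awalk_verts a q)"
    by (rule awalk_verts_arc1) (simp add: q)
  \<comment> \<open>The \<open>tl\<close> drops the shared vertex \<open>z\<close>; on a path, the
    vertices of \<open>q\<close> and the remaining ones of \<open>r\<close> are disjoint.\<close>
  moreover have "head G f \<in> set (tl (awalk_verts (awlast a q) r))"
    using r qr(3) hd_in_awalk_verts(1)[of "head G f" r' b] by (auto simp: awalk_Cons_iff)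
  ultimately show False
    using apath_decomp_disjoint[OF p qr(1)] eq by metis
qed

lemma connected_inducedI:
  assumes D: "D \<noteq> {}" "D \<subseteq> verts G"
    and paths: "\<And>a b. a \<in> D \<Longrightarrow> b \<in> D \<Longrightarrow> \<exists>p. awalk a p b \<and> set (awalk_verts a p) \<subseteq> D"
  shows "connected (G \<restriction> D)"
proof -
  interpret GD: wf_digraph "G \<restriction> D" by (rule wellformed_induce_subgraph)
  have "a \<rightarrow>\<^sup>*\<^bsub>G \<restriction> D\<^esub> b" if ab: "a \<in> D" "b \<in> D" for a b
  proof -
    obtain p where p: "awalk a p b" "set (awalk_verts a p) \<subseteq> D"
      using paths[OF ab] by blast
    \<comment> \<open>Both ends of every arc of \<open>p\<close> are visited vertices, hence in
      \<open>D\<close>, so the arc survives in the induced subgraph.\<close>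
    have "GD.awalk a p b"
      using p ab awalk_verts_arc1[of _ p a] awalk_verts_arc2[OF p(1)]
        compatible_cas[OF compatible_induce_subgraph[of G D]]
      by (auto simp: GD.awalk_def)
    then show ?thesis by (rule GD.reachable_awalkI)
  qed
  then have "strongly_connected (G \<restriction> D)"
    using D(1) by (intro strongly_connectedI) auto
  then show ?thesis
    unfolding connected_def strongly_connected_def
    by (auto intro: GD.reachable_mk_symmetricI)
qed

text \<open>An induced subgraph of a graph is symmetric again, so connectedness of \<open>D\<close>,
  which disregards directions, still yields directed walks inside \<open>D\<close>.\<close>

lemma strongly_connected_induced:
  assumes "connected (G \<restriction> D)" "D \<subseteq> verts G"
  shows "strongly_connected (G \<restriction> D)"
proof -
  have "induced_subgraph (G \<restriction> D) G" using assms(2) by (rule induced_induce)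
  then interpret GD: graph "G \<restriction> D"
    by (simp add: graph_def pseudo_graph_def digraphI_induced digraph.axioms induced_graph_imp_graph)
  show ?thesis using assms(1) by (rule GD.strongly_connected_if_connected)
qed

lemma weakly_convex_imp_connected:
  assumes "weakly_convex G D" "D \<noteq> {}"
  shows "connected (G \<restriction> D)"
proof (rule connected_inducedI)
  show "\<exists>p. awalk a p b \<and> set (awalk_verts a p) \<subseteq> D" if "a \<in> D" "b \<in> D" for a b
    using assms(1) that unfolding weakly_convex_def shortest_path_def
    by (blast intro: awalkI_apath)
qed (use assms in \<open>auto simp: weakly_convex_def\<close>)

section \<open>Short cycles from weak convexity\<close>

lemma girth_le_length:
  assumes "awalk u p u" "distinct (tl (awalk_verts u p))" "3 \<le> length p"
  shows "girth G \<le> enat (length p)"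
  unfolding girth_def
  by (rule INF_lower) (use assms in \<open>auto simp: cycle_def\<close>)

text \<open>Two paths sharing only their ends close up to a cycle; the bound 3 rules out one edge
  traversed back and forth.\<close>

lemma girth_le_sum_apaths:
  assumes p: "apath u p x" and q: "apath x q u" and "u \<noteq> x"
    and disj: "set (awalk_verts u p) \<inter> set (awalk_verts x q) \<subseteq> {u, x}"
    and len: "3 \<le> length p + length q"
  shows "girth G \<le> enat (length p + length q)"
proof -
  have walk: "awalk u p x" "awalk x q u" using p q by (auto intro: awalkI_apath)
  then have pq: "awalk u (p @ q) u" by auto
  obtain P where P: "awalk_verts u p = u # P"
    using walk(1) by (metis awhd_of_awalk awalk_verts_non_Nil list.collapse)
  obtain Q where Q: "awalk_verts x q = x # Q"
    using walk(2) by (metis awhd_of_awalk awalk_verts_non_Nil list.collapse)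
  have "distinct (u # P)" "distinct (x # Q)"
    using p q P Q by (auto simp: apath_def)
  moreover have "awalk_verts u (p @ q) = u # P @ Q"
    using awalk_verts_append[OF pq] P Q by (metis append_Cons list.sel(3) awalkE' walk(1))
  \<comment> \<open>A common element of \<open>P\<close> and \<open>Q\<close> would be
    \<open>u\<close> or \<open>x\<close>, but \<open>u\<close> is not in \<open>P\<close> and
    \<open>x\<close> is not in \<open>Q\<close>.\<close>
  ultimately have "distinct (tl (awalk_verts u (p @ q)))"
    using disj \<open>u \<noteq> x\<close> by (auto simp: P Q)
  then show ?thesis
    using pq len girth_le_length[of u "p @ q"] by simp
qed

text \<open>Each arc is replaced by its opposite, which exists by symmetry. This allows path lengths
  in the two directions to be compared.\<close>

lemma awalk_reverse:
  assumes "awalk x q u"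
  obtains q' where "awalk u q' x" "awalk_verts u q' = rev (awalk_verts x q)"
  using assms
proof (induction q arbitrary: x thesis)
  case Nil
  then show ?case by (auto simp: awalk_Nil_iff intro: Nil.prems(1)[of "[]"])
next
  case (Cons e es)
  then have e: "e \<in> arcs G" "tail G e = x" and es: "awalk (head G e) es u"
    by (auto simp: awalk_Cons_iff)
  from Cons.IH[OF _ es] obtain r
    where r: "awalk u r (head G e)" "awalk_verts u r = rev (awalk_verts (head G e) es)" by blast
  from e obtain f where f: "f \<in> arcs G" "tail G f = head G e" "head G f = x"
    using sym_arcs by (fastforce simp: symmetric_conv)
  have rf: "awalk u (r @ [f]) x"
    using r(1) f by (auto simp: awalk_simps)
  have "awalk_verts u (r @ [f]) = awalk_verts u r @ [x]"
    using awalk_verts_append[OF rf] f by simp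
  then show ?case using Cons.prems(1)[OF rf] r(2) e(2) by simp
qed

text \<open>A shortest path back from \<open>u\<close> to \<open>x\<close> inside \<open>D\<close>
  is no longer than \<open>q\<close> and meets it only in the ends, so together they form a
  cycle.\<close>

lemma weakly_convex_detour_girth:
  assumes "weakly_convex G D" and q: "apath x q u" and "x \<in> D" "u \<in> D" "x \<noteq> u"
    and outside: "set (awalk_verts x q) \<inter> D \<subseteq> {x, u}" and "2 \<le> length q"
  shows "girth G \<le> enat (2 * length q)"
proof -
  obtain p where p: "shortest_path G u p x" "set (awalk_verts u p) \<subseteq> D"
    using assms unfolding weakly_convex_def by blast
  then have path: "apath u p x" by (simp add: shortest_path_def)
  \<comment> \<open>Minimality of \<open>p\<close> speaks of paths from \<open>u\<close> to
    \<open>x\<close>, so \<open>q\<close> has to be reversed first.\<close>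
  obtain q' where q': "awalk u q' x" "awalk_verts u q' = rev (awalk_verts x q)"
    using awalk_reverse[OF awalkI_apath[OF q]] by blast
  then have "apath u q' x" using q by (simp add: apath_def)
  moreover have "length q' = length q"
    using arg_cong[OF q'(2), of length] by (simp add: length_awalk_verts)
  ultimately have le: "length p \<le> length q" using p(1) by (auto simp: shortest_path_def)
  have "p \<noteq> []" using path \<open>x \<noteq> u\<close> by (auto simp: apath_Nil_iff)
  then have "3 \<le> length p + length q" using \<open>2 \<le> length q\<close> by (cases p) auto
  then have "girth G \<le> enat (length p + length q)"
    using p(2) outside \<open>x \<noteq> u\<close> by (intro girth_le_sum_apaths[OF path q]) auto
  also have "\<dots> \<le> enat (2 * length q)" using le by simp
  finally show ?thesis .
qed

lemma non_end_vertex_in_weakly_convex: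
  assumes girth: "7 \<le> girth G" and conv: "weakly_convex G D" and dom: "dominating_set G D"
    and v: "v \<in> verts G" "\<not> end_vertex G v"
  shows "v \<in> D"
proof (rule ccontr)
  assume "v \<notin> D"
  have long: False if "girth G \<le> enat k" "k \<le> 6" for k
  proof -
    have "7 \<le> enat k" using girth that(1) by (rule order_trans)
    then have "7 \<le> k" by (simp add: numeral_eq_enat)
    then show False using that(2) by simp
  qed
  obtain u where u: "u \<in> D" "v \<rightarrow>\<^bsub>G\<^esub> u"
    using dom v \<open>v \<notin> D\<close> by (auto simp: dominating_set_def)
  then obtain w where w: "v \<rightarrow>\<^bsub>G\<^esub> w" "w \<noteq> u"
    using v(2) by (auto simp: end_vertex_iff)
  obtain vu where vu: "vu \<in> arcs G" "tail G vu = v" "head G vu = u"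
    using u(2) by (auto simp: arcs_ends_conv)
  obtain wv where wv: "wv \<in> arcs G" "tail G wv = w" "head G wv = v"
    using graph_symmetric[OF w(1)] by (auto simp: arcs_ends_conv)
  have neq: "u \<noteq> v" "w \<noteq> v" using u(2) w(1) adj_not_same by blast+
  have verts: "u \<in> verts G" "w \<in> verts G" using u(2) w(1) adj_in_verts by blast+
  have path2: "apath w [wv, vu] u"
    using vu wv w(2) neq verts by (auto simp: apath_simps)
  show False
  proof (cases "w \<in> D")
    case True
    \<comment> \<open>The detour \<open>w\<close>, \<open>v\<close>, \<open>u\<close> gives a cycle
      of length at most 4.\<close>
    have "girth G \<le> enat (2 * length [wv, vu])"
      by (rule weakly_convex_detour_girth[OF conv path2])
        (use True u(1) w(2) wv vu \<open>v \<notin> D\<close> in auto)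
    then show False by (rule long) simp
  next
    case False
    then obtain x where x: "x \<in> D" "w \<rightarrow>\<^bsub>G\<^esub> x"
      using dom verts by (auto simp: dominating_set_def)
    then have x': "x \<noteq> w" "x \<noteq> v" using False \<open>v \<notin> D\<close> by auto
    obtain xw where xw: "xw \<in> arcs G" "tail G xw = x" "head G xw = w"
      using graph_symmetric[OF x(2)] by (auto simp: arcs_ends_conv)
    show False
    proof (cases "x = u")
      case True
      \<comment> \<open>Here \<open>u\<close>, \<open>w\<close>, \<open>v\<close> form a
        triangle.\<close>
      have "girth G \<le> enat (length [xw, wv, vu])"
        by (rule girth_le_length[of u])
          (use True xw wv vu verts neq w(2) in \<open>auto simp: awalk_simps\<close>)
      then show False by (rule long) simp
    next
      case False
      then have path3: "apath x [xw, wv, vu] u"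
        using path2 xw wv vu x' by (auto simp: apath_Cons_iff)
      \<comment> \<open>The detour \<open>x\<close>, \<open>w\<close>, \<open>v\<close>,
        \<open>u\<close> gives a cycle of length at most 6, the largest bound among the three
        cases.\<close>
      have "girth G \<le> enat (2 * length [xw, wv, vu])"
        by (rule weakly_convex_detour_girth[OF conv path3])
          (use False \<open>w \<notin> D\<close> \<open>v \<notin> D\<close> u(1) x(1) xw wv vu in auto)
      then show False by (rule long) simp
    qed
  qed
qed

section \<open>The set of non-end-vertices\<close>

text \<open>No edge leaves \<open>{u, v}\<close>, so by connectivity there are no other
  vertices.\<close>

lemma adjacent_end_vertices_imp_card_2:
  assumes sc: "strongly_connected G" and "end_vertex G u" "end_vertex G v" "u \<rightarrow>\<^bsub>G\<^esub> v"
  shows "card (verts G) = 2"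
proof -
  have vu: "v \<rightarrow>\<^bsub>G\<^esub> u" using assms(4) by (rule graph_symmetric)
  have nbr: "y = v" if "u \<rightarrow>\<^bsub>G\<^esub> y" for y
    using that assms(2,4) by (auto simp: end_vertex_iff)
  have nbr': "y = u" if "v \<rightarrow>\<^bsub>G\<^esub> y" for y
    using that assms(3) vu by (auto simp: end_vertex_iff)
  have "x \<in> {u, v}" if "u \<rightarrow>\<^sup>*\<^bsub>G\<^esub> x" for x
    using that by (induction rule: reachable_induct) (auto dest: nbr nbr')
  then have "verts G \<subseteq> {u, v}"
    using sc adj_in_verts[OF vu] unfolding strongly_connected_def by blast
  then have "verts G = {u, v}" using adj_in_verts[OF vu] by blast
  moreover have "u \<noteq> v" using assms(4) adj_not_same by blast
  ultimately show ?thesis by simp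
qed

lemma end_vertex_neighbour:
  assumes "strongly_connected G" "card (verts G) \<noteq> 2" "end_vertex G v"
  obtains u where "v \<rightarrow>\<^bsub>G\<^esub> u" "u \<in> verts G" "\<not> end_vertex G u"
proof -
  obtain u where "v \<rightarrow>\<^bsub>G\<^esub> u" using assms(3) by (auto simp: end_vertex_iff)
  then show ?thesis
    using that assms adjacent_end_vertices_imp_card_2 adj_in_verts by blast
qed

lemma dominating_set_non_end_vertices:
  assumes "strongly_connected G" "card (verts G) \<noteq> 2"
  shows "dominating_set G {v \<in> verts G. \<not> end_vertex G v}"
  unfolding dominating_set_def using end_vertex_neighbour[OF assms] by blast

lemma weakly_convex_non_end_vertices:
  assumes "strongly_connected G"
  shows "weakly_convex G {v \<in> verts G. \<not> end_vertex G v}"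
proof -
  have "\<exists>p. shortest_path G a p b \<and> set (awalk_verts a p) \<subseteq> {v \<in> verts G. \<not> end_vertex G v}"
    if ab: "a \<in> verts G" "\<not> end_vertex G a" "b \<in> verts G" "\<not> end_vertex G b" for a b
  proof -
    obtain p where p: "shortest_path G a p b" using ex_shortest_path[OF assms ab(1,3)] .
    then have path: "apath a p b" by (simp add: shortest_path_def)
    then have "set (awalk_verts a p) \<subseteq> verts G" by (auto simp: apath_def)
    moreover have "\<not> end_vertex G z" if "z \<in> set (awalk_verts a p)" for z
      using end_vertex_on_apath[OF path that] ab by blast
    ultimately show ?thesis using p by blast
  qed
  then show ?thesis by (simp add: weakly_convex_def)
qed

lemma card_non_end_vertices:
  "card {v \<in> verts G. \<not> end_vertex G v} = card (verts G) - card {v. end_vertex G v}"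
proof -
  have "{v \<in> verts G. \<not> end_vertex G v} = verts G - {v. end_vertex G v}" by blast
  moreover have "{v. end_vertex G v} \<subseteq> verts G" by (auto simp: end_vertex_def)
  ultimately show ?thesis by (simp add: card_Diff_subset finite_subset[OF _ finite_verts])
qed

section \<open>Evaluating the two domination numbers\<close>

text \<open>\<open>P\<close> stands for weak convexity or connectedness; finiteness gives
  \<open>Min\<close> its meaning in both definitions.\<close>

lemma finite_dominating_sets: "finite {D. dominating_set G D \<and> P D}"
  by (rule finite_subset[of _ "Pow (verts G)"]) (auto simp: dominating_set_def)

lemma gamma_wcon_eqI:
  assumes "dominating_set G D" "weakly_convex G D" "card D = k"
    and "\<And>D'. dominating_set G D' \<Longrightarrow> weakly_convex G D' \<Longrightarrow> k \<le> card D'"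
  shows "gamma_wcon G = k"
  unfolding gamma_wcon_def
  by (rule Min_eqI) (use assms finite_dominating_sets in auto)

lemma gamma_c_le:
  assumes "connected_dominating_set G D"
  shows "gamma_c G \<le> card D"
  unfolding gamma_c_def connected_dominating_set_def
  by (rule Min_le) (use assms finite_dominating_sets in \<open>auto simp: connected_dominating_set_def\<close>)

lemma gamma_c_eqI:
  assumes "connected_dominating_set G D" "card D = k"
    and "\<And>D'. connected_dominating_set G D' \<Longrightarrow> k \<le> card D'"
  shows "gamma_c G = k"
  unfolding gamma_c_def
proof (rule Min_eqI)
  show "finite (card ` {D. connected_dominating_set G D})"
    unfolding connected_dominating_set_def by (intro finite_imageI finite_dominating_sets)
qed (use assms in auto)

text \<open>The non-end-vertices form the least weakly convex dominating set with respect to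
  inclusion, hence also one of minimum size.\<close>

lemma gamma_wcon_eq_card_non_end_vertices:
  assumes "strongly_connected G" "card (verts G) \<noteq> 2" "7 \<le> girth G"
  shows "gamma_wcon G = card {v \<in> verts G. \<not> end_vertex G v}"
proof (rule gamma_wcon_eqI)
  fix D assume D: "dominating_set G D" "weakly_convex G D"
  then have "finite D" by (auto simp: dominating_set_def intro: finite_subset[OF _ finite_verts])
  then show "card {v \<in> verts G. \<not> end_vertex G v} \<le> card D"
    by (rule card_mono) (use non_end_vertex_in_weakly_convex[OF assms(3) D(2,1)] in blast)
qed (use assms dominating_set_non_end_vertices weakly_convex_non_end_vertices in auto)

section \<open>Cut-vertices and connected domination\<close>

text \<open>If \<open>v\<close> were outside \<open>D\<close>, deleting it would leave
  \<open>D\<close> connected and every other vertex in \<open>D\<close> or adjacent to it, so the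
  graph would stay connected.\<close>

lemma cut_vertex_in_connected_dominating_set:
  assumes sc: "strongly_connected G" and D: "connected_dominating_set G D"
    and v: "cut_vertex G v"
  shows "v \<in> D"
proof (rule ccontr)
  assume "v \<notin> D"
  let ?H = "del_vert v"
  interpret H: wf_digraph ?H by (rule wf_digraph_del_vert)
  have dom: "dominating_set G D" and DV: "D \<subseteq> verts G" and conn: "connected (G \<restriction> D)"
    using D by (auto simp: connected_dominating_set_def dominating_set_def)
  have scD: "strongly_connected (G \<restriction> D)"
    using conn DV by (rule strongly_connected_induced)
  have adj: "x \<rightarrow>\<^bsub>?H\<^esub> y" if "x \<rightarrow>\<^bsub>G\<^esub> y" "x \<noteq> v" "y \<noteq> v" for x y
    using that by (fastforce simp: arcs_ends_conv del_vert_simps)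
  have sub: "subgraph (G \<restriction> D) ?H"
    using \<open>v \<notin> D\<close> DV
    by (intro subgraphI) (auto simp: del_vert_simps compatible_def H.wf_digraph)
  have inD: "x \<rightarrow>\<^sup>*\<^bsub>?H\<^esub> y" if "x \<in> D" "y \<in> D" for x y
    using scD that sub by (auto simp: strongly_connected_def intro: H.reachable_mono)
  \<comment> \<open>Both directions are recorded so that any two remaining vertices can be linked
    through \<open>D\<close>.\<close>
  have toD: "\<exists>d \<in> D. x \<rightarrow>\<^sup>*\<^bsub>?H\<^esub> d \<and> d \<rightarrow>\<^sup>*\<^bsub>?H\<^esub> x" if x: "x \<in> verts G" "x \<noteq> v" for x
  proof (cases "x \<in> D")
    case True
    then show ?thesis using inD by blast
  next
    case False
    then obtain d where d: "d \<in> D" "x \<rightarrow>\<^bsub>G\<^esub> d" using dom x by (auto simp: dominating_set_def)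
    then have "x \<rightarrow>\<^bsub>?H\<^esub> d" "d \<rightarrow>\<^bsub>?H\<^esub> x"
      using adj graph_symmetric x(2) \<open>v \<notin> D\<close> by blast+
    then show ?thesis using d(1) H.reachable_adjI by blast
  qed
  have "x \<rightarrow>\<^sup>*\<^bsub>?H\<^esub> y" if "x \<in> verts ?H" "y \<in> verts ?H" for x y
    using toD[of x] toD[of y] that inD H.reachable_trans by (simp add: verts_del_vert) meson
  moreover have "verts ?H \<noteq> {}"
    using scD DV \<open>v \<notin> D\<close> by (auto simp: verts_del_vert strongly_connected_def)
  ultimately have "strongly_connected ?H" by auto
  then show False
    using v sc by (simp add: cut_vertex_def strongly_connected_card_sccs_verts)
qed

lemma strongly_connected_del_non_cut_vertex:
  assumes sc: "strongly_connected G" and "card (verts G) \<noteq> 1" "v \<in> verts G" "\<not> cut_vertex G v"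
  shows "strongly_connected (del_vert v)"
proof -
  let ?H = "del_vert v"
  interpret H: wf_digraph ?H by (rule wf_digraph_del_vert)
  interpret H: fin_digraph ?H by (rule fin_digraph_del_vert)
  have "card H.sccs_verts \<le> 1"
    using assms by (simp add: cut_vertex_def strongly_connected_card_sccs_verts)
  then have one: "S = T" if "S \<in> H.sccs_verts" "T \<in> H.sccs_verts" for S T
    using that H.finite_sccs_verts by (auto simp: card_le_Suc0_iff_eq)
  have "x \<rightarrow>\<^sup>*\<^bsub>?H\<^esub> y" if "x \<in> verts ?H" "y \<in> verts ?H" for x y
  proof -
    have "H.scc_of x = H.scc_of y"
      using that H.scc_of_in_sccs_verts one by blast
    then show ?thesis using H.in_scc_of_self[OF that(2)] by (auto simp: H.scc_of_def)
  qed
  \<comment> \<open>The count alone would also allow no component at all; a second vertex of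
    \<open>G\<close> excludes this.\<close>
  moreover have "verts ?H \<noteq> {}"
    using assms(2,3) by (auto simp: verts_del_vert card_1_singleton_iff)
  ultimately show ?thesis by auto
qed

text \<open>Since \<open>v\<close> has no end-vertex as a neighbour, every end-vertex keeps its
  dominating neighbour, and \<open>v\<close> itself is dominated by any of its neighbours.\<close>

lemma connected_dominating_set_del_vertex:
  assumes sc: "strongly_connected G" and c: "card (verts G) \<noteq> 1" "card (verts G) \<noteq> 2"
    and v: "v \<in> verts G" "\<not> end_vertex G v" "\<not> cut_vertex G v"
  shows "connected_dominating_set G ({w \<in> verts G. \<not> end_vertex G w} - {v})"
    (is "connected_dominating_set G ?D")
proof -
  let ?H = "del_vert v"
  interpret H: wf_digraph ?H by (rule wf_digraph_del_vert)
  have scH: "strongly_connected ?H"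
    using sc c(1) v(1,3) by (rule strongly_connected_del_non_cut_vertex)
  have nbr: "\<not> end_vertex G w" if w: "v \<rightarrow>\<^bsub>G\<^esub> w" for w
  proof
    assume e: "end_vertex G w"
    have wv: "w \<rightarrow>\<^bsub>G\<^esub> v" using w by (rule graph_symmetric)
    obtain w' where w': "v \<rightarrow>\<^bsub>G\<^esub> w'" "w' \<noteq> w"
      using w v(2) by (auto simp: end_vertex_iff)
    have "w \<noteq> v" "w' \<noteq> v" using w w'(1) adj_not_same by blast+
    moreover have "w \<in> verts G" "w' \<in> verts G" using w w'(1) adj_in_verts by blast+
    \<comment> \<open>The end-vertex \<open>w\<close> has \<open>v\<close> as its only neighbour and
      is isolated once \<open>v\<close> is deleted, so it cannot reach the other neighbour
      \<open>w'\<close>.\<close>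
    ultimately have "w \<rightarrow>\<^sup>*\<^bsub>?H\<^esub> w'"
      using scH by (auto simp: strongly_connected_def verts_del_vert)
    then obtain y where "w \<rightarrow>\<^bsub>?H\<^esub> y"
      using w'(2) by (cases rule: H.converse_reachable_cases) auto
    then have "w \<rightarrow>\<^bsub>G\<^esub> y" "y \<noteq> v" by (auto simp: arcs_ends_conv del_vert_simps)
    then show False using e wv by (auto simp: end_vertex_iff)
  qed
  obtain u where u: "v \<rightarrow>\<^bsub>G\<^esub> u" using ex_neighbour[OF sc c(1) v(1)] .
  then have uD: "u \<in> ?D"
    using nbr adj_in_verts adj_not_same by blast
  have "\<exists>d \<in> ?D. w \<rightarrow>\<^bsub>G\<^esub> d" if w: "w \<in> verts G - ?D" for w
  proof (cases "w = v")
    case True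
    then show ?thesis using u uD by blast
  next
    case False
    then have e: "end_vertex G w" using w by blast
    obtain d where d: "w \<rightarrow>\<^bsub>G\<^esub> d" "d \<in> verts G" "\<not> end_vertex G d"
      using end_vertex_neighbour[OF sc c(2) e] .
    moreover have "d \<noteq> v" using nbr graph_symmetric d(1) e by blast
    ultimately show ?thesis by blast
  qed
  then have "dominating_set G ?D" by (auto simp: dominating_set_def)
  moreover have "connected (G \<restriction> ?D)"
  proof (rule connected_inducedI)
    fix a b assume ab: "a \<in> ?D" "b \<in> ?D"
    then have "a \<rightarrow>\<^sup>*\<^bsub>?H\<^esub> b"
      using scH by (auto simp: strongly_connected_def verts_del_vert)
    \<comment> \<open>A path of the graph without \<open>v\<close> avoids \<open>v\<close>; as it is
      also a path of \<open>G\<close>, its interior contains no end-vertex of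
      \<open>G\<close>.\<close>
    then obtain p where pH: "H.apath a p b" using H.reachable_apath by blast
    then have p: "apath a p b" using subgraph_del_vert by (rule subgraph_apath_imp_apath)
    have "compatible ?H G" by (simp add: compatible_def del_vert_simps)
    then have "set (awalk_verts a p) \<subseteq> verts ?H"
      using pH by (auto simp: H.apath_def compatible_awalk_verts[of ?H G, symmetric])
    moreover have "\<not> end_vertex G z" if "z \<in> set (awalk_verts a p)" for z
      using end_vertex_on_apath[OF p that] ab by blast
    ultimately show "\<exists>p. awalk a p b \<and> set (awalk_verts a p) \<subseteq> ?D"
      using awalkI_apath[OF p] by (auto simp: verts_del_vert)
  qed (use uD in auto)
  ultimately show ?thesis by (simp add: connected_dominating_set_def)
qed

lemma gamma_c_eq_card_non_end_vertices_iff: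
  assumes sc: "strongly_connected G" and c: "card (verts G) \<noteq> 1" "card (verts G) \<noteq> 2"
  shows "gamma_c G = card {v \<in> verts G. \<not> end_vertex G v} \<longleftrightarrow>
    (\<forall>v \<in> verts G. end_vertex G v \<or> cut_vertex G v)"
    (is "gamma_c G = card ?N \<longleftrightarrow> ?ends_or_cuts")
proof
  assume eq: "gamma_c G = card ?N"
  show ?ends_or_cuts
  proof (rule ccontr)
    assume "\<not> ?ends_or_cuts"
    then obtain v where v: "v \<in> verts G" "\<not> end_vertex G v" "\<not> cut_vertex G v" by blast
    have "gamma_c G \<le> card (?N - {v})"
      by (intro gamma_c_le connected_dominating_set_del_vertex sc c v)
    moreover have "card (?N - {v}) < card ?N"
      by (rule card_Diff1_less) (use v in auto)
    ultimately show False using eq by simp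
  qed
next
  assume ?ends_or_cuts
  have dom: "dominating_set G ?N" using sc c(2) by (rule dominating_set_non_end_vertices)
  \<comment> \<open>The empty set cannot dominate the nonempty graph \<open>G\<close>.\<close>
  moreover have "?N \<noteq> {}"
    using dom sc by (auto simp: dominating_set_def strongly_connected_def)
  ultimately have "connected_dominating_set G ?N"
    using weakly_convex_imp_connected[OF weakly_convex_non_end_vertices[OF sc]]
    by (simp add: connected_dominating_set_def)
  then show "gamma_c G = card ?N"
  proof (rule gamma_c_eqI[OF _ refl])
    fix D assume D: "connected_dominating_set G D"
    then have "finite D"
      by (auto simp: connected_dominating_set_def dominating_set_def
          intro: finite_subset[OF _ finite_verts])
    moreover have "?N \<subseteq> D"
      using \<open>?ends_or_cuts\<close> cut_vertex_in_connected_dominating_set[OF sc D] by blast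
    ultimately show "card ?N \<le> card D" by (rule card_mono)
  qed
qed

section \<open>The graph with two vertices\<close>

lemma card_2_neighbour:
  assumes sc: "strongly_connected G" and c: "card (verts G) = 2" and v: "v \<in> verts G"
  obtains w where "v \<rightarrow>\<^bsub>G\<^esub> w" "verts G = {v, w}"
proof -
  obtain w where w: "v \<rightarrow>\<^bsub>G\<^esub> w" using ex_neighbour[OF sc _ v] c by auto
  moreover have "v \<noteq> w" using w adj_not_same by blast
  then have "verts G = {v, w}"
    using c adj_in_verts[OF w] by (auto simp: card_2_iff)
  ultimately show ?thesis by (rule that)
qed

lemma card_2_end_vertex:
  assumes sc: "strongly_connected G" and c: "card (verts G) = 2" and v: "v \<in> verts G"
  shows "end_vertex G v"
proof -
  obtain w where w: "v \<rightarrow>\<^bsub>G\<^esub> w" "verts G = {v, w}" using card_2_neighbour[OF assms] .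
  then have "y = w" if "v \<rightarrow>\<^bsub>G\<^esub> y" for y
    using that w(2) adj_in_verts(2)[OF that] adj_not_same by (metis empty_iff insert_iff)
  then show ?thesis using w(1) by (auto simp: end_vertex_iff)
qed

text \<open>A single vertex dominates the other and is weakly convex through the empty path, while
  the empty set does not dominate.\<close>

lemma card_2_gamma:
  assumes sc: "strongly_connected G" and c: "card (verts G) = 2"
  shows "gamma_wcon G = 1" "gamma_c G = 1"
proof -
  obtain v where v: "v \<in> verts G" using sc by (auto simp: strongly_connected_def)
  obtain w where w: "v \<rightarrow>\<^bsub>G\<^esub> w" and V: "verts G = {v, w}"
    using card_2_neighbour[OF sc c v] .
  have dom: "dominating_set G {v}"
    using graph_symmetric[OF w] by (auto simp: dominating_set_def V)
  have conv: "weakly_convex G {v}"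
    using v by (auto simp: weakly_convex_def shortest_path_def apath_Nil_iff intro!: exI[of _ "[]"])
  have ge: "1 \<le> card D" if "dominating_set G D" for D
  proof -
    have "D \<noteq> {}" "finite D"
      using that v by (auto simp: dominating_set_def intro: finite_subset[OF _ finite_verts])
    then show ?thesis by (simp add: Suc_le_eq card_gt_0_iff)
  qed
  show "gamma_wcon G = 1"
    using dom conv by (rule gamma_wcon_eqI) (use ge in auto)
  have "connected (G \<restriction> {v})"
    using conv by (rule weakly_convex_imp_connected) simp
  then show "gamma_c G = 1"
    by (intro gamma_c_eqI[of "{v}"]) (use dom ge in \<open>auto simp: connected_dominating_set_def\<close>)
qed

end

text \<open>On two vertices both are end-vertices, so \<open>n - n_L\<close> is 0 while
  \<open>gamma_wcon G\<close> is 1. On one vertex both domination numbers are 1, but the vertex is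
  neither an end-vertex nor a cut-vertex. The guards on \<open>n\<close> exclude these two
  cases.\<close>

theorem theorem2p10:
  fixes G :: "('a, 'b) pre_digraph" and n n_L :: nat
  assumes "graph G"
    and "Digraph_Component.connected G"
    and "n = card (verts G)"
    and "girth G \<ge> 7"
    and "n_L = card {v. end_vertex G v}"
  shows "(n \<noteq> 2 \<longrightarrow> gamma_wcon G = n - n_L) \<and>
    (n \<noteq> 1 \<longrightarrow>
      (gamma_wcon G = gamma_c G \<longleftrightarrow> (\<forall>v \<in> verts G. end_vertex G v \<or> cut_vertex G v)))"
proof -
  interpret graph G by fact
  have sc: "strongly_connected G" using assms(2) by (rule strongly_connected_if_connected)
  show ?thesis
  proof (cases "n = 2")
    case True
    \<comment> \<open>Only the equivalence remains, and both of its sides are true.\<close>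
    then show ?thesis
      using card_2_gamma[OF sc] card_2_end_vertex[OF sc] assms(3) by simp
  next
    case False
    then have wcon: "gamma_wcon G = card {v \<in> verts G. \<not> end_vertex G v}"
      using gamma_wcon_eq_card_non_end_vertices[OF sc _ assms(4)] assms(3) by simp
    then have "gamma_wcon G = n - n_L"
      using card_non_end_vertices assms(3,5) by simp
    moreover have "gamma_wcon G = gamma_c G \<longleftrightarrow>
        (\<forall>v \<in> verts G. end_vertex G v \<or> cut_vertex G v)" if "n \<noteq> 1"
      using gamma_c_eq_card_non_end_vertices_iff[OF sc] that False assms(3) wcon by metis
    ultimately show ?thesis by blast
  qed
qed

end
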